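(* Let $\Phi=(G,\varphi)$ be a $\mathbb{T}$-gain graph on a connected graph $G$ with at least one edge. Then $$\mathcal{E}_{\Phi}(v_i)\geq\frac{d_i}{\Delta(G)}\quad\text{for all } v_i\in V(G).$$ Equality holds (for all vertices) if and only if $\Phi\sim(K_{d,d},1)$ for some $d$.
   Context: A $\mathbb{T}$-gain graph $\Phi=(G,\varphi)$ consists of a finite simple graph $G$ with vertices $v_1,\dots,v_n$ and a map $\varphi$ assigning to each orientation $\overrightarrow{e_{p,q}}$ of each edge $v_pv_q$ a value in $\mathbb{T}=\{z\in\mathbb{C}:|z|=1\}$, with $\varphi(\overrightarrow{e_{q,p}})=\varphi(\overrightarrow{e_{p,q}})^{-1}$. Its adjacency matrix $A(\Phi)$ is the Hermitian matrix whose $(p,q)$ entry is $\varphi(\overrightarrow{e_{p,q}})$ if $v_p\sim v_q$ and $0$ otherwise. The energy of the vertex $v_i$ is $\mathcal{E}_{\Phi}(v_i)$, the $(i,i)$ entry of $(A(\Phi)A(\Phi)^* )^{1/2}$. $d_i$ is the degree of $v_i$ and $\Delta(G)$ the maximum degree. $\Phi\sim\Phi'$ means $A(\Phi')=UA(\Phi)U^*$ for a diagonal unitary $U$; $(H,1)$ is the gain graph on $H$ with all gains $1$. *)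

theory Defs
  imports "Graph_Theory.Graph_Theory" "Jordan_Normal_Form.Schur_Decomposition"
begin

text \<open>
  A finite simple graph is a \<open>pair_graph\<close>: a finite, symmetric, loop-free set of arcs, so that
  the edge joining \<open>u\<close> and \<open>v\<close> is represented by its two orientations \<open>(u, v)\<close> and \<open>(v, u)\<close>.
  The gain is constrained only on these arcs; its values elsewhere are never used.
\<close>

locale gain_graph = pair_graph G for G :: "'a pair_pre_digraph" +
  fixes \<phi> :: "'a \<times> 'a \<Rightarrow> complex"
  assumes gain_unit: "e \<in> parcs G \<Longrightarrow> cmod (\<phi> e) = 1"
    and gain_reverse: "(u, v) \<in> parcs G \<Longrightarrow> \<phi> (v, u) = inverse (\<phi> (u, v))"

text \<open>The list \<open>vs\<close> is the numbering of the vertices (starting at index 0).\<close>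

definition adjacency_mat :: "'a list \<Rightarrow> 'a pair_pre_digraph \<Rightarrow> ('a \<times> 'a \<Rightarrow> complex) \<Rightarrow> complex mat" where
  "adjacency_mat vs G \<phi> = mat (length vs) (length vs)
     (\<lambda>(p, q). if (vs ! p, vs ! q) \<in> parcs G then \<phi> (vs ! p, vs ! q) else 0)"

definition hermitian_mat :: "complex mat \<Rightarrow> bool" where
  "hermitian_mat M \<longleftrightarrow> square_mat M \<and> mat_adjoint M = M"

definition psd_mat :: "complex mat \<Rightarrow> bool" where
  "psd_mat M \<longleftrightarrow> hermitian_mat M \<and>
     (\<forall>x \<in> carrier_vec (dim_row M). Re ((M *\<^sub>v x) \<bullet>c x) \<ge> 0)"

text \<open>
  The power \<open>M\<^sup>1\<^sup>/\<^sup>2\<close> of a positive semidefinite matrix \<open>M\<close>: its unique positive semidefinite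
  square root.
\<close>

definition psd_sqrt :: "complex mat \<Rightarrow> complex mat" where
  "psd_sqrt M = (THE B. B \<in> carrier_mat (dim_row M) (dim_row M) \<and> psd_mat B \<and> B * B = M)"

text \<open>
  The diagonal entries of a Hermitian matrix are real, so taking the real part only changes the
  type of the energy.
\<close>

definition vertex_energy ::
  "'a list \<Rightarrow> 'a pair_pre_digraph \<Rightarrow> ('a \<times> 'a \<Rightarrow> complex) \<Rightarrow> nat \<Rightarrow> real" where
  "vertex_energy vs G \<phi> i =
     Re (psd_sqrt (adjacency_mat vs G \<phi> * mat_adjoint (adjacency_mat vs G \<phi>)) $$ (i, i))"

text \<open>In a \<open>pair_graph\<close>, the arcs leaving a vertex correspond to the edges incident with it.\<close>

definition vertex_degree :: "'a pair_pre_digraph \<Rightarrow> 'a \<Rightarrow> nat" where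
  "vertex_degree G v = out_degree (with_proj G) v"

definition max_degree :: "'a pair_pre_digraph \<Rightarrow> nat" where
  "max_degree G = Max (vertex_degree G ` pverts G)"

definition unitary_mat :: "complex mat \<Rightarrow> bool" where
  "unitary_mat U \<longleftrightarrow> square_mat U \<and> U * mat_adjoint U = 1\<^sub>m (dim_row U)"

text \<open>Both gain graphs live on the vertices numbered by \<open>vs\<close>.\<close>

definition switching_equivalent ::
  "'a list \<Rightarrow> 'a pair_pre_digraph \<Rightarrow> ('a \<times> 'a \<Rightarrow> complex) \<Rightarrow>
   'a pair_pre_digraph \<Rightarrow> ('a \<times> 'a \<Rightarrow> complex) \<Rightarrow> bool" where
  "switching_equivalent vs G \<phi> G' \<phi>' \<longleftrightarrow>
     (\<exists>U \<in> carrier_mat (length vs) (length vs). diagonal_mat U \<and> unitary_mat U \<and>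
        adjacency_mat vs G' \<phi>' = U * adjacency_mat vs G \<phi> * mat_adjoint U)"

end

theory Submission
  imports Defs "Jordan_Normal_Form.Spectral_Radius"
begin

text \<open>
  Let \<open>A\<close> be the adjacency matrix and \<open>|A| = (A A\<^sup>*)\<^sup>1\<^sup>/\<^sup>2\<close>. The row sums of \<open>A\<close> bound its
  eigenvalues \<open>\<lambda>\<close> by \<open>\<Delta>\<close>, so \<open>\<Delta>|A| - A\<^sup>2\<close> has eigenvalues \<open>|\<lambda>|(\<Delta> - |\<lambda>|) \<ge> 0\<close>; its diagonal entries
  \<open>\<Delta> \<E>(v\<^sub>i) - d\<^sub>i\<close> are therefore nonnegative. They all vanish iff every \<open>|\<lambda>|\<close> is \<open>0\<close> or \<open>\<Delta>\<close>, that is, iff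
  \<open>A\<^sup>3 = \<Delta>\<^sup>2 A\<close>. An entry of \<open>A\<^sup>3\<close> at an edge is a sum of at most \<open>\<Delta>\<^sup>2\<close> unit gains of walks of length 3,
  so the equation forces every neighbour of one endpoint to be adjacent to every neighbour of the
  other, with all these walks having the gain of the edge: \<open>G\<close> is \<open>K\<^sub>\<Delta>\<^sub>,\<^sub>\<Delta>\<close>, and it is balanced.
\<close>

section \<open>The spectral theorem for Hermitian matrices\<close>

lemma mat_adjoint_conv:
  "mat_adjoint (A :: complex mat) = mat (dim_col A) (dim_row A) (\<lambda>(i, j). cnj (A $$ (j, i)))"
  by (rule eq_matI) (auto simp: mat_adjoint_def mat_of_rows_def)

lemma mat_adjoint_index [simp]:
  "i < dim_col A \<Longrightarrow> j < dim_row A \<Longrightarrow> mat_adjoint (A :: complex mat) $$ (i, j) = cnj (A $$ (j, i))"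
  by (simp add: mat_adjoint_conv)

lemma mat_adjoint_dim [simp]:
  "dim_row (mat_adjoint (A :: complex mat)) = dim_col A"
  "dim_col (mat_adjoint (A :: complex mat)) = dim_row A"
  by (auto simp: mat_adjoint_conv)

lemma mat_adjoint_carrier [simp, intro]:
  "(A :: complex mat) \<in> carrier_mat n m \<Longrightarrow> mat_adjoint A \<in> carrier_mat m n"
  by (auto simp: mat_adjoint_conv)

lemma mat_adjoint_adjoint [simp]: "mat_adjoint (mat_adjoint (A :: complex mat)) = A"
  by (rule eq_matI) auto

lemma mat_adjoint_mult:
  assumes "(A :: complex mat) \<in> carrier_mat n m" "B \<in> carrier_mat m k"
  shows "mat_adjoint (A * B) = mat_adjoint B * mat_adjoint A"
  using assms by (intro eq_matI) (auto simp: scalar_prod_def mult.commute intro!: sum.cong)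

lemma mat_adjoint_mat_diag [simp]:
  "mat_adjoint (mat_diag n (d :: nat \<Rightarrow> complex)) = mat_diag n (\<lambda>i. cnj (d i))"
  by (rule eq_matI) (auto simp: mat_diag_def)

lemma adjoint_scalar_prod:
  assumes A: "(A :: complex mat) \<in> carrier_mat n m" and x: "x \<in> carrier_vec m" and y: "y \<in> carrier_vec n"
  shows "(A *\<^sub>v x) \<bullet>c y = x \<bullet>c (mat_adjoint A *\<^sub>v y)"
proof -
  have "(A *\<^sub>v x) \<bullet>c y = (\<Sum>i<n. \<Sum>j<m. A $$ (i, j) * x $ j * cnj (y $ i))"
    using assms by (auto simp: scalar_prod_def sum_distrib_right lessThan_atLeast0 intro!: sum.cong)
  also have "\<dots> = (\<Sum>j<m. \<Sum>i<n. A $$ (i, j) * x $ j * cnj (y $ i))"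
    by (rule sum.swap)
  also have "\<dots> = x \<bullet>c (mat_adjoint A *\<^sub>v y)"
    using assms by (auto simp: scalar_prod_def sum_distrib_left lessThan_atLeast0 mult_ac intro!: sum.cong)
  finally show ?thesis .
qed

text \<open>Complete \<open>v\<close> to a basis and apply Gram-Schmidt, which leaves the head of
  the list unchanged, then normalise. The scalar \<open>c\<close> stays abstract because only the
  line spanned by \<open>v\<close> matters for an eigenvector.\<close>

lemma unitary_completion:
  assumes v: "(v :: complex vec) \<in> carrier_vec n" and v0: "v \<noteq> 0\<^sub>v n"
  obtains W c where "W \<in> carrier_mat n n" "mat_adjoint W * W = 1\<^sub>m n" "col W 0 = c \<cdot>\<^sub>v v"
proof -
  interpret cof_vec_space n "TYPE(complex)" .
  define b where "b = basis_completion v"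
  define ws where "ws = gram_schmidt n b"
  from basis_completion[OF v v0, folded b_def]
  have dist_b: "distinct b" and indep: "\<not> lin_dep (set b)" and b: "set b \<subseteq> carrier_vec n"
    and hdb: "hd b = v" and len_b: "length b = n" by auto
  have n: "n > 0"
    using v v0 by (metis carrier_vecD eq_vecI index_zero_vec(2) less_nat_zero_code not_gr_zero)
  from hdb len_b n obtain vs where bv: "b = v # vs" by (cases b) auto
  from gram_schmidt_result[OF b dist_b indep refl, folded ws_def]
  have ws: "set ws \<subseteq> carrier_vec n" "corthogonal ws" "length ws = n"
    by (auto simp: len_b)
  have "hd ws = v"
    unfolding ws_def using gram_schmidt_hd[OF v, of vs, folded bv] .
  then have ws0: "ws ! 0 = v"
    using ws(3) n by (metis hd_conv_nth list.size(3) nat_neq_iff)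
  have car: "ws ! i \<in> carrier_vec n" if "i < n" for i
    using ws that by auto
  \<comment> \<open>The vectors of \<open>ws\<close> are orthogonal but not normalised;
    \<open>r i\<close> is the norm of the i-th one. It is positive because
    \<open>corthogonal\<close> also excludes zero self-products.\<close>
  define r where "r i = sqrt (Re (ws ! i \<bullet>c ws ! i))" for i
  have pos: "ws ! i \<bullet>c ws ! i = of_real (r i * r i)" "r i > 0" if "i < n" for i
  proof -
    have nz: "ws ! i \<bullet>c ws ! i \<noteq> 0"
      using ws that by (auto simp: corthogonal_def)
    have *: "ws ! i \<bullet>c ws ! i = of_real (\<Sum>j<n. (cmod (ws ! i $ j))\<^sup>2)"
      using car[OF that]
      by (auto simp: scalar_prod_def lessThan_atLeast0 complex_norm_square simp del: of_real_power)
    have "(\<Sum>j<n. (cmod (ws ! i $ j))\<^sup>2) \<ge> 0"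
      by (intro sum_nonneg) auto
    with * nz have "(\<Sum>j<n. (cmod (ws ! i $ j))\<^sup>2) > 0"
      by (metis less_eq_real_def of_real_0)
    with * show "ws ! i \<bullet>c ws ! i = of_real (r i * r i)" "r i > 0"
      by (auto simp: r_def simp del: of_real_sum of_real_mult)
  qed
  define W where "W = mat n n (\<lambda>(i, j). ws ! j $ i / of_real (r j))"
  have W: "W \<in> carrier_mat n n"
    by (simp add: W_def)
  have "mat_adjoint W * W = 1\<^sub>m n"
  proof (rule eq_matI)
    fix i j assume "i < dim_row (1\<^sub>m n :: complex mat)" "j < dim_col (1\<^sub>m n :: complex mat)"
    then have ij: "i < n" "j < n" by auto
    have "(mat_adjoint W * W) $$ (i, j) = (\<Sum>k<n. cnj (W $$ (k, i)) * W $$ (k, j))"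
      using W ij by (auto simp: scalar_prod_def lessThan_atLeast0 intro!: sum.cong)
    also have "\<dots> = (\<Sum>k<n. ws ! j $ k * cnj (ws ! i $ k)) / (of_real (r i) * of_real (r j))"
      unfolding sum_divide_distrib using ij by (intro sum.cong) (auto simp: W_def)
    also have "(\<Sum>k<n. ws ! j $ k * cnj (ws ! i $ k)) = ws ! j \<bullet>c ws ! i"
      using car[OF ij(1)] car[OF ij(2)] by (auto simp: scalar_prod_def lessThan_atLeast0 intro!: sum.cong)
    finally have eq: "(mat_adjoint W * W) $$ (i, j) = ws ! j \<bullet>c ws ! i / (of_real (r i) * of_real (r j))" .
    show "(mat_adjoint W * W) $$ (i, j) = 1\<^sub>m n $$ (i, j)"
    proof (cases "i = j")
      case True
      then show ?thesis using eq pos[OF ij(1)] ij by simp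
    next
      case False
      then have "ws ! j \<bullet>c ws ! i = 0"
        using ws ij unfolding corthogonal_def by metis
      then show ?thesis using eq False ij by simp
    qed
  qed (use W in auto)
  moreover have "col W 0 = (1 / of_real (r 0)) \<cdot>\<^sub>v v"
    using n v by (intro eq_vecI) (auto simp: W_def ws0)
  ultimately show thesis
    using W that by blast
qed

text \<open>A one-sided inverse of a square matrix is two-sided, so \<open>W\<close> and its adjoint
  witness a similarity. In this form unitary conjugations can be composed by transitivity and
  assembled from blocks.\<close>

lemma adjoint_similar_mat_wit:
  assumes A: "A \<in> carrier_mat n n" and W: "W \<in> carrier_mat n n" and WW: "mat_adjoint W * W = (1\<^sub>m n :: complex mat)"
  shows "similar_mat_wit A (mat_adjoint W * A * W) W (mat_adjoint W)"
proof -
  have WW': "W * mat_adjoint W = 1\<^sub>m n"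
    using mat_mult_left_right_inverse[OF _ W WW] W by auto
  have "W * (mat_adjoint W * A * W) * mat_adjoint W = (W * mat_adjoint W) * A * (W * mat_adjoint W)"
    using A W by (smt (verit, ccfv_threshold) assoc_mult_mat mat_adjoint_carrier mult_carrier_mat)
  also have "\<dots> = A"
    unfolding WW' using A by simp
  finally show ?thesis
    using A W WW WW' by (intro similar_mat_witI[of _ _ n]) auto
qed

text \<open>Induction by deflation: a unitary whose first column is an eigenvector splits off a 1 by
  1 block, and the remaining block is again Hermitian.\<close>

lemma hermitian_spectral:
  assumes "A \<in> carrier_mat n n" and "mat_adjoint A = (A :: complex mat)"
  shows "\<exists>U d. U \<in> carrier_mat n n \<and> mat_adjoint U * U = 1\<^sub>m n \<and>
    A = U * mat_diag n (\<lambda>k. of_real (d k)) * mat_adjoint U"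
  using assms
proof (induction n arbitrary: A)
  case 0
  then show ?case
    by (intro exI[of _ "1\<^sub>m 0"] exI[of _ "\<lambda>_. 0"]) auto
next
  case (Suc n)
  note A = Suc.prems(1) and herm = Suc.prems(2)
  from spectrum_non_empty[OF A] obtain e where "eigenvalue A e"
    by (auto simp: spectrum_def)
  then obtain v where v: "v \<in> carrier_vec (Suc n)" "v \<noteq> 0\<^sub>v (Suc n)" "A *\<^sub>v v = e \<cdot>\<^sub>v v"
    using A by (auto simp: eigenvalue_def eigenvector_def)
  obtain W c where W: "W \<in> carrier_mat (Suc n) (Suc n)" and WW: "mat_adjoint W * W = 1\<^sub>m (Suc n)"
    and colW: "col W 0 = c \<cdot>\<^sub>v v"
    using unitary_completion[OF v(1,2)] by blast
  define D where "D = mat_adjoint W * A * W"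
  have D: "D \<in> carrier_mat (Suc n) (Suc n)"
    unfolding D_def using A W by auto
  have hermD: "mat_adjoint D = D"
  proof -
    have "mat_adjoint D = mat_adjoint W * mat_adjoint (mat_adjoint W * A)"
      unfolding D_def using A W by (intro mat_adjoint_mult) auto
    also have "mat_adjoint (mat_adjoint W * A) = A * W"
      using A W herm by (simp add: mat_adjoint_mult[of _ "Suc n" "Suc n" _ "Suc n"])
    finally show ?thesis
      unfolding D_def using A W by (simp add: assoc_mult_mat[of _ "Suc n" "Suc n" _ "Suc n" _ "Suc n"])
  qed
  have "A *\<^sub>v col W 0 = e \<cdot>\<^sub>v col W 0"
    unfolding colW using A v by (simp add: mult_mat_vec smult_smult_assoc mult.commute)
  moreover have "col D 0 = mat_adjoint W *\<^sub>v (A *\<^sub>v col W 0)"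
  proof -
    have "D = mat_adjoint W * (A * W)"
      unfolding D_def using A W by (intro assoc_mult_mat) auto
    then have "col D 0 = mat_adjoint W *\<^sub>v col (A * W) 0"
      using A W by (simp only:) (rule col_mult2[of _ "Suc n" "Suc n" _ "Suc n"]; auto)
    also have "col (A * W) 0 = A *\<^sub>v col W 0"
      using A W by (intro col_mult2[of _ "Suc n" "Suc n" _ "Suc n"]) auto
    finally show ?thesis .
  qed
  moreover have "mat_adjoint W *\<^sub>v (e \<cdot>\<^sub>v col W 0) = e \<cdot>\<^sub>v (mat_adjoint W *\<^sub>v col W 0)"
    using mult_mat_vec[OF mat_adjoint_carrier[OF W], of "col W 0" e] col_dim[of W 0] W by simp
  moreover have "mat_adjoint W *\<^sub>v col W 0 = col (mat_adjoint W * W) 0"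
    using W by (intro col_mult2[of _ "Suc n" "Suc n" _ "Suc n", symmetric]) auto
  ultimately have colD: "col D 0 = e \<cdot>\<^sub>v col (1\<^sub>m (Suc n)) 0"
    by (simp only: WW)
  have D0: "D $$ (i, 0) = (if i = 0 then e else 0)" if "i < Suc n" for i
    using arg_cong[OF colD, of "\<lambda>x. x $ i"] that D by (auto split: if_splits)
  have D0': "D $$ (0, i) = cnj (D $$ (i, 0))" if "i < Suc n" for i
    using arg_cong[OF hermD, of "\<lambda>X. X $$ (0, i)"] that D by auto
  \<comment> \<open>Hermitian symmetry clears the rest of the first row of \<open>D\<close> and, at
    the corner, makes the eigenvalue real.\<close>
  have cnj_e: "cnj e = e"
    using D0[of 0] D0'[of 0] by simp
  then have e: "e = of_real (Re e)"
    by (metis Reals_cnj_iff of_real_Re)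
  define E where "E = mat n n (\<lambda>(i, j). D $$ (Suc i, Suc j))"
  have E: "E \<in> carrier_mat n n"
    by (simp add: E_def)
  have "mat_adjoint E = E"
  proof (rule eq_matI)
    fix i j assume "i < dim_row E" "j < dim_col E"
    then have "i < n" "j < n" using E by auto
    then show "mat_adjoint E $$ (i, j) = E $$ (i, j)"
      using arg_cong[OF hermD, of "\<lambda>X. X $$ (Suc i, Suc j)"] D by (auto simp: E_def)
  qed (use E in auto)
  from Suc.IH[OF E this] obtain V d where V: "V \<in> carrier_mat n n" and VV: "mat_adjoint V * V = 1\<^sub>m n"
    and EV: "E = V * mat_diag n (\<lambda>k. of_real (d k)) * mat_adjoint V" by blast
  have VV': "V * mat_adjoint V = 1\<^sub>m n"
    using mat_mult_left_right_inverse[OF _ V VV] V by auto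
  \<comment> \<open>The unitary \<open>V\<close> of the smaller block is extended by 1 in the
    corner. \<open>Q\<close> is written out blockwise to fit the block similarity rule and is then
    recognised as the adjoint of \<open>P\<close>.\<close>
  define P where "P = four_block_mat (1\<^sub>m 1) (0\<^sub>m 1 n) (0\<^sub>m n 1) V"
  define Q where "Q = four_block_mat (1\<^sub>m 1) (0\<^sub>m 1 n) (0\<^sub>m n 1) (mat_adjoint V)"
  \<comment> \<open>Index 0 holds the eigenvalue split off, so the smaller spectrum is shifted by
    one.\<close>
  define d' where "d' k = (if k = 0 then Re e else d (k - 1))" for k
  have P: "P \<in> carrier_mat (Suc n) (Suc n)"
    using V by (auto simp: P_def)
  have Q: "Q = mat_adjoint P"
    using V by (intro eq_matI) (auto simp: P_def Q_def)
  have "D = four_block_mat (mat 1 1 (\<lambda>_. e)) (0\<^sub>m 1 n) (0\<^sub>m n 1) E"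
    using D D0 D0' cnj_e by (intro eq_matI) (auto simp: E_def)
  moreover have "similar_mat_wit (four_block_mat (mat 1 1 (\<lambda>_. e)) (0\<^sub>m 1 n) (0\<^sub>m n 1) E)
      (four_block_mat (mat 1 1 (\<lambda>_. e)) (0\<^sub>m 1 n) (0\<^sub>m n 1) (mat_diag n (\<lambda>k. of_real (d k)))) P Q"
    unfolding P_def Q_def
  proof (rule similar_mat_wit_four_block)
    show "similar_mat_wit (mat 1 1 (\<lambda>_. e)) (mat 1 1 (\<lambda>_. e)) (1\<^sub>m 1) (1\<^sub>m 1)"
      by (rule similar_mat_wit_refl) auto
    show "similar_mat_wit E (mat_diag n (\<lambda>k. of_real (d k))) V (mat_adjoint V)"
      using V VV VV' E EV by (intro similar_mat_witI[of _ _ n]) auto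
  qed (use V E in auto)
  moreover have "four_block_mat (mat 1 1 (\<lambda>_. e)) (0\<^sub>m 1 n) (0\<^sub>m n 1) (mat_diag n (\<lambda>k. of_real (d k)))
      = mat_diag (Suc n) (\<lambda>k. of_real (d' k))"
    using e by (intro eq_matI) (auto simp: mat_diag_def d'_def)
  ultimately have "similar_mat_wit D (mat_diag (Suc n) (\<lambda>k. of_real (d' k))) P (mat_adjoint P)"
    using Q by simp
  from similar_mat_wit_trans[OF adjoint_similar_mat_wit[OF A W WW, folded D_def] this]
  have "similar_mat_wit A (mat_diag (Suc n) (\<lambda>k. of_real (d' k))) (W * P) (mat_adjoint (W * P))"
    using mat_adjoint_mult[OF W P] by simp
  from similar_mat_witD2[OF A this] show ?case by blast
qed

section \<open>Square roots of positive semidefinite matrices\<close>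

text \<open>The dimensions in the carrier premises cannot be read off the conclusions; fixing all of
  them to \<open>n\<close> lets the simplifier reassociate products of square matrices.\<close>

lemmas square_mult_simps = assoc_mult_mat[of _ n n _ n _ n] mult_carrier_mat[of _ n n _ n]
  right_mult_one_mat[of _ n n] left_mult_one_mat[of _ n n] for n

text \<open>Functional calculus: for a fixed unitary \<open>U\<close>, algebra with these matrices
  is pointwise algebra with the real function \<open>d\<close>.\<close>

definition unitary_diag :: "nat \<Rightarrow> complex mat \<Rightarrow> (nat \<Rightarrow> real) \<Rightarrow> complex mat" where
  "unitary_diag n U d = U * mat_diag n (\<lambda>k. of_real (d k)) * mat_adjoint U"

lemma unitary_diag_carrier [simp]: "U \<in> carrier_mat n n \<Longrightarrow> unitary_diag n U d \<in> carrier_mat n n"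
  unfolding unitary_diag_def by (intro mult_carrier_mat) auto

lemma unitary_diag_dim [simp]:
  "U \<in> carrier_mat n n \<Longrightarrow> dim_row (unitary_diag n U d) = n"
  "U \<in> carrier_mat n n \<Longrightarrow> dim_col (unitary_diag n U d) = n"
  using unitary_diag_carrier by blast+

lemma unitary_diag_index:
  assumes "U \<in> carrier_mat n n" "i < n" "j < n"
  shows "unitary_diag n U d $$ (i, j) = (\<Sum>k<n. of_real (d k) * (U $$ (i, k) * cnj (U $$ (j, k))))"
  unfolding unitary_diag_def mat_diag_mult_right[OF assms(1)]
  using assms by (auto simp: scalar_prod_def lessThan_atLeast0 intro!: sum.cong)

text \<open>The weights are nonnegative, so sign conditions on the spectrum pass to the diagonal.
  This is how statements about eigenvalues become statements about vertex energies.\<close>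

lemma unitary_diag_diagonal:
  assumes "U \<in> carrier_mat n n" "i < n"
  shows "unitary_diag n U d $$ (i, i) = of_real (\<Sum>k<n. d k * (cmod (U $$ (i, k)))\<^sup>2)"
  using assms by (simp add: unitary_diag_index flip: complex_norm_square)

lemma unitary_diag_mult:
  assumes U: "U \<in> carrier_mat n n" and UU: "mat_adjoint U * U = 1\<^sub>m n"
  shows "unitary_diag n U a * unitary_diag n U b = unitary_diag n U (\<lambda>k. a k * b k)"
proof -
  define X where "X = mat_diag n (\<lambda>k. complex_of_real (a k))"
  define Y where "Y = mat_diag n (\<lambda>k. complex_of_real (b k))"
  have c: "X \<in> carrier_mat n n" "Y \<in> carrier_mat n n" "mat_adjoint U \<in> carrier_mat n n"
    using U by (auto simp: X_def Y_def)
  have "U * X * mat_adjoint U * (U * Y * mat_adjoint U) = U * X * (mat_adjoint U * U) * (Y * mat_adjoint U)"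
    using U c by (simp add: square_mult_simps[where n = n])
  also have "\<dots> = U * (X * Y) * mat_adjoint U"
    unfolding UU using U c by (simp add: square_mult_simps[where n = n])
  finally show ?thesis
    by (simp add: unitary_diag_def X_def Y_def)
qed

lemma unitary_diag_adjoint [simp]:
  assumes "U \<in> carrier_mat n n"
  shows "mat_adjoint (unitary_diag n U d) = unitary_diag n U d"
  using assms by (intro eq_matI) (auto simp: unitary_diag_index mult_ac)

text \<open>In the coordinates y = U* x the quadratic form is the sum of the \<open>d k\<close>
  weighted by the squared moduli of the entries of y.\<close>

lemma unitary_diag_psd:
  assumes U: "U \<in> carrier_mat n n" and d: "\<And>k. k < n \<Longrightarrow> d k \<ge> 0"
  shows "psd_mat (unitary_diag n U d)"
  unfolding psd_mat_def hermitian_mat_def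
proof (intro conjI ballI)
  show "square_mat (unitary_diag n U d)"
    using unitary_diag_carrier[OF U, of d] by auto
  show "mat_adjoint (unitary_diag n U d) = unitary_diag n U d"
    using U by simp
  fix x :: "complex vec" assume "x \<in> carrier_vec (dim_row (unitary_diag n U d))"
  then have x: "x \<in> carrier_vec n"
    using unitary_diag_carrier[OF U, of d] by auto
  define y where "y = mat_adjoint U *\<^sub>v x"
  define X where "X = mat_diag n (\<lambda>k. complex_of_real (d k))"
  have y: "y \<in> carrier_vec n"
    using mult_mat_vec_carrier[OF mat_adjoint_carrier[OF U] x] by (simp add: y_def)
  have X: "X \<in> carrier_mat n n"
    by (auto simp: X_def)
  have Xy: "X *\<^sub>v y \<in> carrier_vec n"
    using X y by auto
  have "unitary_diag n U d *\<^sub>v x = U *\<^sub>v (X *\<^sub>v y)"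
    unfolding unitary_diag_def X_def[symmetric] y_def using U X x
    by (smt (verit, best) assoc_mult_mat_vec mat_adjoint_carrier mult_carrier_mat mult_mat_vec_carrier)
  then have "(unitary_diag n U d *\<^sub>v x) \<bullet>c x = (X *\<^sub>v y) \<bullet>c y"
    using adjoint_scalar_prod[OF U Xy x] by (simp add: y_def)
  also have "\<dots> = (\<Sum>k<n. (X *\<^sub>v y) $ k * cnj (y $ k))"
    using y X by (auto simp: scalar_prod_def lessThan_atLeast0 intro!: sum.cong)
  also have "\<dots> = (\<Sum>k<n. of_real (d k * (cmod (y $ k))\<^sup>2))"
  proof (rule sum.cong)
    fix k assume "k \<in> {..<n}"
    then have k: "k < n" by simp
    have "(X *\<^sub>v y) $ k = (\<Sum>j<n. (if k = j then of_real (d j) else 0) * y $ j)"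
      using y X k by (auto simp: X_def mat_diag_def scalar_prod_def lessThan_atLeast0 intro!: sum.cong)
    also have "\<dots> = (\<Sum>j<n. if k = j then of_real (d j) * y $ j else 0)"
      by (intro sum.cong) auto
    also have "\<dots> = of_real (d k) * y $ k"
      using k by simp
    finally show "(X *\<^sub>v y) $ k * cnj (y $ k) = of_real (d k * (cmod (y $ k))\<^sup>2)"
      by (simp flip: complex_norm_square)
  qed simp
  finally have "(unitary_diag n U d *\<^sub>v x) \<bullet>c x = of_real (\<Sum>k<n. d k * (cmod (y $ k))\<^sup>2)"
    by simp
  then show "0 \<le> Re ((unitary_diag n U d *\<^sub>v x) \<bullet>c x)"
    using d by (auto intro!: sum_nonneg)
qed

lemma psd_spectral:
  assumes B: "B \<in> carrier_mat n n" and psd: "psd_mat B"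
  obtains V t where "V \<in> carrier_mat n n" "mat_adjoint V * V = 1\<^sub>m n"
    "\<And>k. k < n \<Longrightarrow> t k \<ge> 0" "B = unitary_diag n V t"
proof -
  from psd have "mat_adjoint B = B"
    by (simp add: psd_mat_def hermitian_mat_def)
  from hermitian_spectral[OF B this] obtain V t where V: "V \<in> carrier_mat n n"
    and VV: "mat_adjoint V * V = 1\<^sub>m n" and BV: "B = unitary_diag n V t"
    unfolding unitary_diag_def by blast
  have "t k \<ge> 0" if k: "k < n" for k
  proof -
    define u :: "complex vec" where "u = unit_vec n k"
    have u: "u \<in> carrier_vec n" by (simp add: u_def)
    define X where "X = mat_diag n (\<lambda>k. complex_of_real (t k))"
    have X: "X \<in> carrier_mat n n" by (simp add: X_def)
    \<comment> \<open>The test vector is the k-th column of \<open>V\<close>: its coordinates in the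
      eigenbasis form the unit vector, so the quadratic form returns \<open>t k\<close>
      itself.\<close>
    define x where "x = V *\<^sub>v u"
    have x: "x \<in> carrier_vec n" using V u by (auto simp: x_def)
    have Vx: "mat_adjoint V *\<^sub>v x = u"
      unfolding x_def using V u VV
      by (metis assoc_mult_mat_vec mat_adjoint_carrier one_mult_mat_vec)
    have Xu: "X *\<^sub>v u \<in> carrier_vec n" using X u by auto
    have "B *\<^sub>v x = V *\<^sub>v (X *\<^sub>v (mat_adjoint V *\<^sub>v x))"
      unfolding BV unitary_diag_def X_def[symmetric] using V X x
      by (smt (verit, best) assoc_mult_mat_vec mat_adjoint_carrier mult_carrier_mat mult_mat_vec_carrier)
    then have "(B *\<^sub>v x) \<bullet>c x = (X *\<^sub>v u) \<bullet>c u"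
      using adjoint_scalar_prod[OF V Xu x] Vx by simp
    also have "\<dots> = of_real (t k)"
    proof -
      have "conjugate u = u"
        by (intro eq_vecI) (auto simp: u_def unit_vec_def)
      then show ?thesis
        using k Xu by (simp add: u_def scalar_prod_right_unit[of _ n] X_def mat_diag_def)
    qed
    finally show ?thesis
      using psd x B by (auto simp: psd_mat_def)
  qed
  with V VV BV that show thesis by blast
qed

text \<open>If \<open>W = U\<^sup>* V\<close> intertwines \<open>diag(s\<^sup>2)\<close> and \<open>diag(t\<^sup>2)\<close> with \<open>s, t \<ge> 0\<close>, it intertwines
  \<open>diag(s)\<close> and \<open>diag(t)\<close>.\<close>

lemma unitary_diag_square_inj:
  assumes U: "U \<in> carrier_mat n n" and UU: "mat_adjoint U * U = 1\<^sub>m n" and s: "\<And>k. k < n \<Longrightarrow> s k \<ge> 0"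
    and V: "V \<in> carrier_mat n n" and VV: "mat_adjoint V * V = 1\<^sub>m n" and t: "\<And>k. k < n \<Longrightarrow> t k \<ge> 0"
    and eq: "unitary_diag n U (\<lambda>k. s k * s k) = unitary_diag n V (\<lambda>k. t k * t k)"
  shows "unitary_diag n U s = unitary_diag n V t"
proof -
  define W where "W = mat_adjoint U * V"
  have W: "W \<in> carrier_mat n n"
    unfolding W_def using U V by (intro mult_carrier_mat) auto
  have UU': "U * mat_adjoint U = 1\<^sub>m n"
    using mat_mult_left_right_inverse[OF _ U UU] U by auto
  have VV': "V * mat_adjoint V = 1\<^sub>m n"
    using mat_mult_left_right_inverse[OF _ V VV] V by auto
  have car: "mat_adjoint U \<in> carrier_mat n n" "mat_adjoint V \<in> carrier_mat n n"
    using U V by auto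
  note as = square_mult_simps[where n = n]
  have left: "mat_adjoint U * unitary_diag n U a * V = mat_diag n (\<lambda>k. of_real (a k)) * W" for a
  proof -
    have "mat_adjoint U * unitary_diag n U a * V
        = (mat_adjoint U * U) * (mat_diag n (\<lambda>k. of_real (a k)) * W)"
      unfolding unitary_diag_def W_def using U V car by (simp add: as)
    then show ?thesis
      unfolding UU using W by (simp add: as)
  qed
  have right: "mat_adjoint U * unitary_diag n V a * V = W * mat_diag n (\<lambda>k. of_real (a k))" for a
  proof -
    have "mat_adjoint U * unitary_diag n V a * V
        = (W * mat_diag n (\<lambda>k. of_real (a k))) * (mat_adjoint V * V)"
      unfolding unitary_diag_def W_def using U V car by (simp add: as)
    then show ?thesis
      unfolding VV using W by (simp add: as)
  qed
  have "mat_diag n (\<lambda>k. of_real (s k * s k)) * W = W * mat_diag n (\<lambda>k. of_real (t k * t k))"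
    using left[of "\<lambda>k. s k * s k"] right[of "\<lambda>k. t k * t k"] eq by simp
  note comm = this[unfolded mat_diag_mult_left[OF W] mat_diag_mult_right[OF W]]
  have ent: "of_real (s i * s i) * W $$ (i, j) = W $$ (i, j) * of_real (t j * t j)"
    if "i < n" "j < n" for i j
    using arg_cong[OF comm, of "\<lambda>X. X $$ (i, j)"] that by simp
  \<comment> \<open>Where the entry of \<open>W\<close> is nonzero, the squares of
    \<open>s i\<close> and \<open>t j\<close> agree, and nonnegativity removes the sign
    ambiguity.\<close>
  have "of_real (s i) * W $$ (i, j) = W $$ (i, j) * complex_of_real (t j)" if "i < n" "j < n" for i j
  proof (cases "W $$ (i, j) = 0")
    case False
    with ent[OF that] have "complex_of_real (s i * s i) = of_real (t j * t j)"
      by simp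
    then have "s i * s i = t j * t j"
      by (simp only: of_real_eq_iff)
    then have "s i = t j"
      using s[OF that(1)] t[OF that(2)] by (metis abs_of_nonneg real_sqrt_abs2)
    then show ?thesis by simp
  qed simp
  then have "mat_diag n (\<lambda>k. of_real (s k)) * W = W * mat_diag n (\<lambda>k. of_real (t k))"
    unfolding mat_diag_mult_left[OF W] mat_diag_mult_right[OF W] by (intro cong_mat) auto
  then have "mat_adjoint U * unitary_diag n U s * V = mat_adjoint U * unitary_diag n V t * V"
    unfolding left right .
  then have "U * (mat_adjoint U * unitary_diag n U s * V) * mat_adjoint V
      = U * (mat_adjoint U * unitary_diag n V t * V) * mat_adjoint V" by simp
  moreover have "U * (mat_adjoint U * X * V) * mat_adjoint V = X" if X: "X \<in> carrier_mat n n" for X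
  proof -
    have "U * (mat_adjoint U * X * V) * mat_adjoint V = (U * mat_adjoint U) * X * (V * mat_adjoint V)"
      using U V car X by (simp add: as)
    then show ?thesis
      unfolding UU' VV' using X by (simp add: as)
  qed
  ultimately show ?thesis
    using U V by simp
qed

text \<open>\<open>psd_sqrt\<close> is a definite description, so uniqueness is required: any other
  root is diagonalised with nonnegative spectrum, and squaring is injective on such
  matrices.\<close>

lemma psd_sqrt_unitary_diag:
  assumes U: "U \<in> carrier_mat n n" and UU: "mat_adjoint U * U = 1\<^sub>m n" and s: "\<And>k. k < n \<Longrightarrow> s k \<ge> 0"
  shows "psd_sqrt (unitary_diag n U (\<lambda>k. s k * s k)) = unitary_diag n U s"
proof -
  have dim: "dim_row (unitary_diag n U (\<lambda>k. s k * s k)) = n"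
    using unitary_diag_carrier[OF U] by auto
  show ?thesis
    unfolding psd_sqrt_def dim
  proof (rule the_equality)
    show "unitary_diag n U s \<in> carrier_mat n n \<and> psd_mat (unitary_diag n U s) \<and>
        unitary_diag n U s * unitary_diag n U s = unitary_diag n U (\<lambda>k. s k * s k)"
      using unitary_diag_psd[of U n s, OF U s] unitary_diag_mult[OF U UU, of s s] unitary_diag_carrier[OF U]
      by blast
    fix B assume B: "B \<in> carrier_mat n n \<and> psd_mat B \<and> B * B = unitary_diag n U (\<lambda>k. s k * s k)"
    obtain V t where V: "V \<in> carrier_mat n n" "mat_adjoint V * V = 1\<^sub>m n"
      and t: "\<And>k. k < n \<Longrightarrow> t k \<ge> 0" and BV: "B = unitary_diag n V t"
      using psd_spectral[OF conjunct1[OF B] conjunct1[OF conjunct2[OF B]]] by blast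
    have "unitary_diag n V (\<lambda>k. t k * t k) = unitary_diag n U (\<lambda>k. s k * s k)"
      using B unitary_diag_mult[OF V, of t t] by (simp add: BV)
    from unitary_diag_square_inj[of V n t U s, OF V t U UU s this] show "B = unitary_diag n U s"
      unfolding BV .
  qed
qed

section \<open>Eigenvalue bound and energy inequality for Hermitian matrices\<close>

text \<open>Read the eigenvector equation at a coordinate of maximal modulus.\<close>

lemma unitary_diag_bound:
  assumes U: "U \<in> carrier_mat n n" and UU: "mat_adjoint U * U = 1\<^sub>m n"
    and row: "\<And>i. i < n \<Longrightarrow> (\<Sum>j<n. cmod (unitary_diag n U d $$ (i, j))) \<le> r"
    and k: "k < n"
  shows "\<bar>d k\<bar> \<le> r"
proof -
  define A where "A = unitary_diag n U d"
  have A: "A \<in> carrier_mat n n"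
    using U by (simp add: A_def)
  \<comment> \<open>This says that column \<open>k\<close> of \<open>U\<close> is an eigenvector of
    \<open>A\<close> for \<open>d k\<close>.\<close>
  have "A * U = U * mat_diag n (\<lambda>k. of_real (d k)) * (mat_adjoint U * U)"
    unfolding A_def unitary_diag_def using U by (intro assoc_mult_mat[of _ n n _ n _ n]) auto
  also have "\<dots> = U * mat_diag n (\<lambda>k. of_real (d k))"
    unfolding UU using U by (simp add: square_mult_simps[where n = n])
  finally have comm: "A * U = mat n n (\<lambda>(i, j). U $$ (i, j) * of_real (d j))"
    unfolding mat_diag_mult_right[OF U] .
  have AU: "(\<Sum>j<n. A $$ (i, j) * U $$ (j, k)) = U $$ (i, k) * of_real (d k)" if "i < n" for i
  proof -
    have "(\<Sum>j<n. A $$ (i, j) * U $$ (j, k)) = (A * U) $$ (i, k)"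
      using A U that k by (auto simp: scalar_prod_def lessThan_atLeast0 intro!: sum.cong)
    then show ?thesis
      unfolding comm using that k by simp
  qed
  define m where "m = Max ((\<lambda>i. cmod (U $$ (i, k))) ` {..<n})"
  have "m \<in> (\<lambda>i. cmod (U $$ (i, k))) ` {..<n}"
    unfolding m_def using k by (intro Max_in) auto
  then obtain i where i: "i < n" "m = cmod (U $$ (i, k))" by auto
  have le: "cmod (U $$ (j, k)) \<le> m" if "j < n" for j
    unfolding m_def using that by (intro Max_ge) auto
  \<comment> \<open>A zero column would contradict unitarity at the entry (k, k).\<close>
  have "m > 0"
  proof (rule ccontr)
    assume "\<not> m > 0"
    then have "U $$ (j, k) = 0" if "j < n" for j
      using le[OF that] by (meson norm_le_zero_iff not_less order_trans)
    then have "(mat_adjoint U * U) $$ (k, k) = 0"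
      using U k by (simp add: scalar_prod_def)
    then show False
      unfolding UU using k by simp
  qed
  have "m * \<bar>d k\<bar> = cmod (\<Sum>j<n. A $$ (i, j) * U $$ (j, k))"
    unfolding AU[OF i(1)] i(2) by (simp add: norm_mult)
  also have "\<dots> \<le> (\<Sum>j<n. cmod (A $$ (i, j)) * m)"
    by (rule order_trans[OF norm_sum]) (auto simp: norm_mult intro!: sum_mono mult_left_mono le)
  also have "\<dots> = m * (\<Sum>j<n. cmod (A $$ (i, j)))"
    by (simp add: sum_distrib_left mult.commute)
  also have "\<dots> \<le> m * r"
    using row[OF i(1)] \<open>m > 0\<close> by (simp add: A_def)
  finally show ?thesis
    using \<open>m > 0\<close> by simp
qed

text \<open>Graph-free form of the result: later \<open>r\<close> is the maximum degree and the
  diagonal of \<open>A * A\<close> consists of the degrees.\<close>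

lemma hermitian_energy_bound:
  assumes A: "A \<in> carrier_mat n n" and herm: "mat_adjoint A = A"
    and row: "\<And>i. i < n \<Longrightarrow> (\<Sum>j<n. cmod (A $$ (i, j))) \<le> r" and r: "r > 0"
  defines "E i \<equiv> Re (psd_sqrt (A * mat_adjoint A) $$ (i, i))"
  shows "\<And>i. i < n \<Longrightarrow> E i \<ge> Re ((A * A) $$ (i, i)) / r"
    and "(\<forall>i<n. E i = Re ((A * A) $$ (i, i)) / r) \<longleftrightarrow> A * A * A = of_real (r\<^sup>2) \<cdot>\<^sub>m A"
proof -
  from hermitian_spectral[OF A herm] obtain U d where U: "U \<in> carrier_mat n n"
    and UU: "mat_adjoint U * U = 1\<^sub>m n" and AU: "A = unitary_diag n U d"
    unfolding unitary_diag_def by blast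
  have dr: "\<bar>d k\<bar> \<le> r" if "k < n" for k
    using unitary_diag_bound[OF U UU _ that, of d r] row by (simp add: AU)
  \<comment> \<open>The square of \<open>d k\<close> is written with absolute values so that the
    nonnegative root can be read off by \<open>psd_sqrt_unitary_diag\<close>.\<close>
  have AA: "A * A = unitary_diag n U (\<lambda>k. \<bar>d k\<bar> * \<bar>d k\<bar>)"
    using unitary_diag_mult[OF U UU, of d d] by (simp add: AU)
  have AAA: "A * A * A = unitary_diag n U (\<lambda>k. d k * d k * d k)"
    using unitary_diag_mult[OF U UU, of d d] unitary_diag_mult[OF U UU, of "\<lambda>k. d k * d k" d] by (simp add: AU)
  have sq: "psd_sqrt (A * mat_adjoint A) = unitary_diag n U (\<lambda>k. \<bar>d k\<bar>)"
    unfolding herm AA by (rule psd_sqrt_unitary_diag[OF U UU]) simp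
  have diff: "r * E i - Re ((A * A) $$ (i, i)) = (\<Sum>k<n. \<bar>d k\<bar> * (r - \<bar>d k\<bar>) * (cmod (U $$ (i, k)))\<^sup>2)"
    if "i < n" for i
    unfolding E_def sq AA unitary_diag_diagonal[OF U that]
    by (simp add: sum_distrib_left sum_subtractf[symmetric] algebra_simps)
  have nn: "\<bar>d k\<bar> * (r - \<bar>d k\<bar>) * (cmod (U $$ (i, k)))\<^sup>2 \<ge> 0" if "k < n" for i k
    using dr[OF that] by simp
  show "E i \<ge> Re ((A * A) $$ (i, i)) / r" if "i < n" for i
  proof -
    have "r * E i - Re ((A * A) $$ (i, i)) \<ge> 0"
      unfolding diff[OF that] using nn by (intro sum_nonneg) auto
    then show ?thesis using r by (simp add: field_simps)
  qed
  have "(\<forall>i<n. E i = Re ((A * A) $$ (i, i)) / r) \<longleftrightarrow>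
      (\<forall>i<n. (\<Sum>k<n. \<bar>d k\<bar> * (r - \<bar>d k\<bar>) * (cmod (U $$ (i, k)))\<^sup>2) = 0)"
  proof -
    have "E i = Re ((A * A) $$ (i, i)) / r \<longleftrightarrow> r * E i - Re ((A * A) $$ (i, i)) = 0" for i
      using r by (auto simp: field_simps)
    then show ?thesis by (simp only: diff cong: imp_cong)
  qed
  also have "\<dots> \<longleftrightarrow> (\<forall>i<n. \<forall>k<n. d k = 0 \<or> \<bar>d k\<bar> = r \<or> U $$ (i, k) = 0)"
    using nn by (subst sum_nonneg_eq_0_iff) auto
  \<comment> \<open>The weights disappear because equality is demanded at every \<open>i\<close> and
    each column of a unitary matrix has a nonzero entry.\<close>
  also have "\<dots> \<longleftrightarrow> (\<forall>k<n. d k = 0 \<or> \<bar>d k\<bar> = r)"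
  proof -
    have "\<exists>i<n. U $$ (i, k) \<noteq> 0" if k: "k < n" for k
    proof (rule ccontr)
      assume "\<not> ?thesis"
      then have "(mat_adjoint U * U) $$ (k, k) = 0"
        using U k by (simp add: scalar_prod_def)
      then show False
        unfolding UU using k by simp
    qed
    then show ?thesis by blast
  qed
  \<comment> \<open>Membership of \<open>d k\<close> in {0, r, -r} becomes a polynomial identity,
    which can be transferred to the matrix.\<close>
  also have "\<dots> \<longleftrightarrow> (\<forall>k<n. d k * d k * d k = r\<^sup>2 * d k)"
  proof -
    have "d k = 0 \<or> \<bar>d k\<bar> = r \<longleftrightarrow> d k * d k * d k = r\<^sup>2 * d k" for k
    proof -
      have "d k * d k * d k = r\<^sup>2 * d k \<longleftrightarrow> d k = 0 \<or> (d k)\<^sup>2 = r\<^sup>2"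
        by (auto simp: power2_eq_square)
      also have "(d k)\<^sup>2 = r\<^sup>2 \<longleftrightarrow> \<bar>d k\<bar> = r"
        using r by (auto simp: power2_eq_iff abs_if)
      finally show ?thesis by blast
    qed
    then show ?thesis by simp
  qed
  also have "\<dots> \<longleftrightarrow> A * A * A = of_real (r\<^sup>2) \<cdot>\<^sub>m A"
  proof -
    have rA: "of_real (r\<^sup>2) \<cdot>\<^sub>m A = unitary_diag n U (\<lambda>k. r\<^sup>2 * d k)"
      using U by (intro eq_matI) (auto simp: AU unitary_diag_index sum_distrib_left mult_ac)
    \<comment> \<open>Conjugating back by \<open>U\<close> recovers the diagonal matrix, so the
      matrix determines the function below \<open>n\<close>.\<close>
    have inj: "a k = b k" if eq: "unitary_diag n U a = unitary_diag n U b" and k: "k < n" for a b k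
    proof -
      have "mat_adjoint U * unitary_diag n U c * U = mat_diag n (\<lambda>k. of_real (c k))" for c
      proof -
        have "mat_adjoint U * unitary_diag n U c * U
            = (mat_adjoint U * U) * mat_diag n (\<lambda>k. of_real (c k)) * (mat_adjoint U * U)"
          unfolding unitary_diag_def using U by (simp add: square_mult_simps[where n = n])
        then show ?thesis unfolding UU by (simp add: square_mult_simps[where n = n])
      qed
      from this[of a] this[of b] eq
      have "mat_diag n (\<lambda>k. complex_of_real (a k)) = mat_diag n (\<lambda>k. of_real (b k))" by simp
      from arg_cong[OF this, of "\<lambda>X. X $$ (k, k)"] k show ?thesis
        by (simp add: mat_diag_def)
    qed
    show ?thesis
    proof
      assume *: "\<forall>k<n. d k * d k * d k = r\<^sup>2 * d k"
      show "A * A * A = of_real (r\<^sup>2) \<cdot>\<^sub>m A"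
        unfolding AAA rA using U * by (intro eq_matI) (auto simp: unitary_diag_index simp del: of_real_mult intro!: sum.cong)
    next
      assume "A * A * A = of_real (r\<^sup>2) \<cdot>\<^sub>m A"
      then show "\<forall>k<n. d k * d k * d k = r\<^sup>2 * d k"
        unfolding AAA rA using inj by blast
    qed
  qed
  finally show "(\<forall>i<n. E i = Re ((A * A) $$ (i, i)) / r) \<longleftrightarrow> A * A * A = of_real (r\<^sup>2) \<cdot>\<^sub>m A" .
qed

section \<open>The equation \<open>A\<^sup>3 = \<Delta>\<^sup>2 A\<close>\<close>

text \<open>Compare real parts: at most \<open>c\<close> terms of real part at most 1 can only sum
  to \<open>c\<close> if there are exactly \<open>c\<close> of them, all of real part 1. The modulus
  bound then kills the imaginary parts.\<close>

lemma sum_unit_disc_extremal: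
  fixes f :: "'b \<Rightarrow> complex"
  assumes fin: "finite S" and norm: "\<And>x. x \<in> S \<Longrightarrow> cmod (f x) \<le> 1"
    and sum: "sum f S = of_nat c" and card: "card S \<le> c"
  shows "card S = c" and "x \<in> S \<Longrightarrow> f x = 1"
proof -
  have nn: "1 - Re (f x) \<ge> 0" if "x \<in> S" for x
    using norm[OF that] complex_Re_le_cmod[of "f x"] by linarith
  have eq: "(\<Sum>x\<in>S. 1 - Re (f x)) = real (card S) - real c"
    using arg_cong[OF sum, of Re] by (simp add: sum_subtractf)
  moreover have "(\<Sum>x\<in>S. 1 - Re (f x)) \<ge> 0"
    using nn by (rule sum_nonneg)
  ultimately show c: "card S = c"
    using card by simp
  assume x: "x \<in> S"
  have "\<forall>x\<in>S. 1 - Re (f x) = 0"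
    using sum_nonneg_eq_0_iff[OF fin, of "\<lambda>x. 1 - Re (f x)"] nn eq c by simp
  then have re: "Re (f x) = 1"
    using x by simp
  have "(cmod (f x))\<^sup>2 \<le> 1"
    using norm[OF x] by (simp add: power_le_one)
  then have "Im (f x) = 0"
    using re by (simp add: cmod_power2)
  with re show "f x = 1"
    by (simp add: complex_eq_iff)
qed

text \<open>The left-hand side of \<open>cube\<close> has at most \<open>d\<^sup>2\<close> nonzero terms, all of modulus 1, so all the
  walks \<open>i, x, y, j\<close> must exist and have the same gain as \<open>i, j\<close>.\<close>

lemma three_walks_extremal:
  fixes a :: "nat \<Rightarrow> nat \<Rightarrow> complex"
  assumes herm: "\<And>i j. i < n \<Longrightarrow> j < n \<Longrightarrow> a j i = cnj (a i j)"
    and unit: "\<And>i j. i < n \<Longrightarrow> j < n \<Longrightarrow> a i j = 0 \<or> cmod (a i j) = 1"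
    and deg: "\<And>i. i < n \<Longrightarrow> card {j. j < n \<and> a i j \<noteq> 0} \<le> d"
    and cube: "(\<Sum>x<n. \<Sum>y<n. a i x * a x y * a y j) = of_nat (d\<^sup>2) * a i j"
    and ij: "i < n" "j < n" "a i j \<noteq> 0"
  shows "card {x. x < n \<and> a i x \<noteq> 0} = d"
    and "\<lbrakk>x < n; a i x \<noteq> 0; y < n; a j y \<noteq> 0\<rbrakk> \<Longrightarrow> a i x * a x y * a y j = a i j"
proof -
  define X where "X = {x. x < n \<and> a i x \<noteq> 0}"
  define Y where "Y = {y. y < n \<and> a j y \<noteq> 0}"
  \<comment> \<open>Since \<open>a i j\<close> has modulus 1, multiplying by its conjugate divides
    by it; walks with the same gain as the edge are thus normalised to the value 1.\<close>
  define f where "f = (\<lambda>(x, y). a i x * a x y * a y j * cnj (a i j))"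
  have fin: "finite X" "finite Y"
    by (auto simp: X_def Y_def)
  have aij: "cmod (a i j) = 1"
    using unit ij by blast
  have le1: "cmod (a p q) \<le> 1" if "p < n" "q < n" for p q
    using unit[OF that] by auto
  \<comment> \<open>\<open>Y\<close> is defined by row \<open>j\<close>, whereas the walks end in
    column \<open>j\<close>; Hermitian symmetry identifies the two supports.\<close>
  have "a y j = 0" if "y < n" "y \<notin> Y" for y
    using herm[OF ij(2) that(1)] that by (simp add: Y_def)
  then have "(\<Sum>y<n. a i x * a x y * a y j) = (\<Sum>y\<in>Y. a i x * a x y * a y j)" for x
    by (intro sum.mono_neutral_right) (auto simp: Y_def)
  moreover have "(\<Sum>x<n. \<Sum>y\<in>Y. a i x * a x y * a y j) = (\<Sum>x\<in>X. \<Sum>y\<in>Y. a i x * a x y * a y j)"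
    by (intro sum.mono_neutral_right) (auto simp: X_def)
  ultimately have "(\<Sum>x\<in>X. \<Sum>y\<in>Y. a i x * a x y * a y j) = of_nat (d\<^sup>2) * a i j"
    using cube by simp
  moreover have "sum f (X \<times> Y) = (\<Sum>x\<in>X. \<Sum>y\<in>Y. a i x * a x y * a y j) * cnj (a i j)"
    unfolding f_def sum.cartesian_product[symmetric] sum_distrib_right ..
  ultimately have "sum f (X \<times> Y) = of_nat (d\<^sup>2) * a i j * cnj (a i j)"
    by simp
  also have "\<dots> = of_nat (d\<^sup>2) * (a i j * cnj (a i j))"
    by (simp add: mult.assoc)
  also have aa: "a i j * cnj (a i j) = 1"
    using aij by (simp add: complex_norm_square[symmetric])
  finally have sum: "sum f (X \<times> Y) = of_nat (d\<^sup>2)"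
    by simp
  have norm: "cmod (f z) \<le> 1" if mem: "z \<in> X \<times> Y" for z
  proof -
    obtain x y where z: "z = (x, y)" "x < n" "y < n"
      using mem by (auto simp: X_def Y_def)
    have "cmod (a i x) * cmod (a x y) * cmod (a y j) * cmod (a i j) \<le> 1 * 1 * 1 * 1"
      using le1 ij z by (intro mult_mono) auto
    then show ?thesis
      by (simp add: f_def z norm_mult)
  qed
  have cX: "card X \<le> d" and cY: "card Y \<le> d"
    using deg ij by (auto simp: X_def Y_def)
  then have le: "card (X \<times> Y) \<le> d\<^sup>2"
    by (simp add: card_cartesian_product power2_eq_square mult_mono)
  have fin': "finite (X \<times> Y)"
    using fin by simp
  note ext = sum_unit_disc_extremal[OF fin' norm sum le]
  have XY: "card X * card Y = d * d"
    using ext(1) by (simp add: card_cartesian_product power2_eq_square)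
  have ne: "X \<noteq> {}"
    using ij by (auto simp: X_def)
  then have "d > 0"
    using cX fin by (metis card_gt_0_iff order_less_le_trans)
  \<comment> \<open>Neither factor of \<open>card X * card Y\<close> exceeds \<open>d\<close>, so a
    product of \<open>d * d\<close> forces each to be \<open>d\<close>; positivity of
    \<open>d\<close> permits the cancellation.\<close>
  have "d * d \<le> card X * d"
    using XY cY by (metis mult_le_mono order_refl)
  with \<open>d > 0\<close> cX show "card {x. x < n \<and> a i x \<noteq> 0} = d"
    by (auto simp: X_def)
  assume "x < n" "a i x \<noteq> 0" "y < n" "a j y \<noteq> 0"
  then have "f (x, y) = 1"
    using ext(2) by (auto simp: X_def Y_def)
  then have "a i x * a x y * a y j * (a i j * cnj (a i j)) = a i j"
    by (simp add: f_def mult.left_commute mult.assoc)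
  then show "a i x * a x y * a y j = a i j"
    by (simp add: aa)
qed

lemma cube_index:
  assumes "(A :: complex mat) \<in> carrier_mat n n" "i < n" "j < n"
  shows "(A * A * A) $$ (i, j) = (\<Sum>x<n. \<Sum>y<n. A $$ (i, x) * A $$ (x, y) * A $$ (y, j))"
  using assms
  by (auto simp: scalar_prod_def sum_distrib_left lessThan_atLeast0 mult.assoc intro!: sum.cong)

lemma cube_eq_iff:
  assumes A: "(A :: complex mat) \<in> carrier_mat n n"
  shows "A * A * A = c \<cdot>\<^sub>m A \<longleftrightarrow>
    (\<forall>i<n. \<forall>j<n. (\<Sum>x<n. \<Sum>y<n. A $$ (i, x) * A $$ (x, y) * A $$ (y, j)) = c * A $$ (i, j))"
  (is "?L \<longleftrightarrow> ?R")
proof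
  assume L: ?L
  show ?R
  proof (intro allI impI)
    fix i j assume ij: "i < n" "j < n"
    show "(\<Sum>x<n. \<Sum>y<n. A $$ (i, x) * A $$ (x, y) * A $$ (y, j)) = c * A $$ (i, j)"
      unfolding cube_index[OF A ij, symmetric] L using A ij by simp
  qed
next
  assume R: ?R
  show ?L
  proof (rule eq_matI)
    fix i j assume "i < dim_row (c \<cdot>\<^sub>m A)" "j < dim_col (c \<cdot>\<^sub>m A)"
    then have ij: "i < n" "j < n"
      using A by auto
    show "(A * A * A) $$ (i, j) = (c \<cdot>\<^sub>m A) $$ (i, j)"
      unfolding cube_index[OF A ij] using R A ij by simp
  qed (use A in auto)
qed

section \<open>Adjacency matrices of gain graphs\<close>

text \<open>Connectedness refers to the symmetric closure, but the arcs of \<open>G\<close> are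
  already symmetric, so every vertex is reached from \<open>u\<close> along arcs of \<open>G\<close>
  without leaving \<open>S\<close>.\<close>

lemma connected_closed_set:
  assumes "gain_graph G \<phi>" and conn: "Digraph_Component.connected (with_proj G)"
    and u: "u \<in> S" "u \<in> pverts G" and closed: "\<And>x y. x \<in> S \<Longrightarrow> (x, y) \<in> parcs G \<Longrightarrow> y \<in> S"
  shows "pverts G \<subseteq> S"
proof
  interpret gain_graph G \<phi> by fact
  fix v assume v: "v \<in> pverts G"
  have "u \<rightarrow>\<^sup>*\<^bsub>mk_symmetric G\<^esub> v"
    using conn u v by (auto simp: Digraph_Component.connected_def strongly_connected_def)
  then have "u \<rightarrow>\<^sup>*\<^bsub>G\<^esub> v"
    using reachable_mk_symmetric_eq sym_arcs by simp
  then show "v \<in> S"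
    by (induction rule: reachable_induct) (use u closed in auto)
qed

lemma card_nth_Collect:
  assumes "distinct vs"
  shows "card {j. j < length vs \<and> vs ! j \<in> S} = card (set vs \<inter> S)"
proof -
  have "bij_betw ((!) vs) {j. j < length vs \<and> vs ! j \<in> S} (set vs \<inter> S)"
    using assms by (auto simp: bij_betw_def inj_on_def nth_eq_iff_index_eq in_set_conv_nth image_def)
  then show ?thesis
    by (rule bij_betw_same_card)
qed

section \<open>Entries, degrees and row sums of the adjacency matrix\<close>

context gain_graph
begin

text \<open>Inverse and conjugate coincide on the unit circle; this is what makes the adjacency
  matrix Hermitian.\<close>

lemma gain_reverse_cnj: "(u, v) \<in> parcs G \<Longrightarrow> \<phi> (v, u) = cnj (\<phi> (u, v))"
  using gain_reverse gain_unit by (metis complex_norm_square inverse_unique mult_1 mult.commute of_real_1 power_one)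

lemma adjacency_index:
  "i < length vs \<Longrightarrow> j < length vs \<Longrightarrow>
    adjacency_mat vs G \<phi> $$ (i, j) = (if (vs ! i, vs ! j) \<in> parcs G then \<phi> (vs ! i, vs ! j) else 0)"
  by (simp add: adjacency_mat_def)

lemma adjacency_carrier [simp]: "adjacency_mat vs G \<phi> \<in> carrier_mat (length vs) (length vs)"
  by (simp add: adjacency_mat_def)

lemma adjacency_dim [simp]:
  "dim_row (adjacency_mat vs G \<phi>) = length vs"
  "dim_col (adjacency_mat vs G \<phi>) = length vs"
  by (simp_all add: adjacency_mat_def)

lemma adjacency_cmod:
  "i < length vs \<Longrightarrow> j < length vs \<Longrightarrow>
    cmod (adjacency_mat vs G \<phi> $$ (i, j)) = (if (vs ! i, vs ! j) \<in> parcs G then 1 else 0)"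
  using gain_unit by (simp add: adjacency_index)

lemma adjacency_eq_0_iff:
  "i < length vs \<Longrightarrow> j < length vs \<Longrightarrow>
    adjacency_mat vs G \<phi> $$ (i, j) = 0 \<longleftrightarrow> (vs ! i, vs ! j) \<notin> parcs G"
  using adjacency_cmod by (metis norm_eq_zero zero_neq_one)

lemma adjacency_sym:
  assumes "i < length vs" "j < length vs"
  shows "adjacency_mat vs G \<phi> $$ (j, i) = cnj (adjacency_mat vs G \<phi> $$ (i, j))"
proof (cases "(vs ! i, vs ! j) \<in> parcs G")
  case True
  then show ?thesis
    using assms arcs_symmetric[OF True] gain_reverse_cnj[OF True] by (simp add: adjacency_index)
next
  case False
  then have "(vs ! j, vs ! i) \<notin> parcs G"
    using arcs_symmetric by blast
  with False show ?thesis
    using assms by (simp add: adjacency_index)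
qed

lemma adjacency_hermitian: "mat_adjoint (adjacency_mat vs G \<phi>) = adjacency_mat vs G \<phi>"
proof (rule eq_matI)
  fix i j assume "i < dim_row (adjacency_mat vs G \<phi>)" "j < dim_col (adjacency_mat vs G \<phi>)"
  then show "mat_adjoint (adjacency_mat vs G \<phi>) $$ (i, j) = adjacency_mat vs G \<phi> $$ (i, j)"
    using adjacency_sym[of j vs i] by simp
qed simp_all

text \<open>Counting positions in \<open>vs\<close> instead of arcs matches the degree with the
  support of a matrix row.\<close>

lemma vertex_degree_conv:
  assumes "distinct vs" "set vs = pverts G"
  shows "vertex_degree G v = card {j. j < length vs \<and> (v, vs ! j) \<in> parcs G}"
proof -
  have "bij_betw (\<lambda>j. (v, vs ! j)) {j. j < length vs \<and> (v, vs ! j) \<in> parcs G} {e \<in> parcs G. fst e = v}"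
    unfolding bij_betw_def
  proof (intro conjI inj_onI equalityI subsetI)
    fix e assume e: "e \<in> {e \<in> parcs G. fst e = v}"
    then obtain w where w: "e = (v, w)" "(v, w) \<in> parcs G" by (cases e) auto
    then have "w \<in> set vs"
      using assms(2) in_arcsD2 by blast
    then obtain j where "j < length vs" "vs ! j = w"
      by (auto simp: in_set_conv_nth)
    with w show "e \<in> (\<lambda>j. (v, vs ! j)) ` {j. j < length vs \<and> (v, vs ! j) \<in> parcs G}"
      by auto
  qed (use assms(1) in \<open>auto simp: nth_eq_iff_index_eq\<close>)
  from bij_betw_same_card[OF this] show ?thesis
    by (simp add: vertex_degree_def out_degree_def out_arcs_def)
qed

lemma vertex_degree_le_max: "v \<in> pverts G \<Longrightarrow> vertex_degree G v \<le> max_degree G"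
  unfolding max_degree_def using pair_finite_verts by (intro Max_ge) auto

lemma max_degree_pos:
  assumes "parcs G \<noteq> {}"
  shows "max_degree G > 0"
proof -
  from assms obtain u v where uv: "(u, v) \<in> parcs G" by auto
  have "out_arcs (with_proj G) u = {e \<in> parcs G. fst e = u}"
    by (simp add: out_arcs_def)
  then have "finite (out_arcs (with_proj G) u)" "out_arcs (with_proj G) u \<noteq> {}"
    using uv pair_finite_arcs by auto
  then have "vertex_degree G u > 0"
    by (simp add: vertex_degree_def out_degree_def card_gt_0_iff)
  with vertex_degree_le_max in_arcsD1[OF uv] show ?thesis
    by (meson order_less_le_trans)
qed

lemma adjacency_row_sum:
  assumes "distinct vs" "set vs = pverts G" "i < length vs"
  shows "(\<Sum>j<length vs. cmod (adjacency_mat vs G \<phi> $$ (i, j))) = real (vertex_degree G (vs ! i))"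
proof -
  have "(\<Sum>j<length vs. cmod (adjacency_mat vs G \<phi> $$ (i, j)))
      = (\<Sum>j<length vs. if (vs ! i, vs ! j) \<in> parcs G then 1 else 0)"
    using assms by (intro sum.cong) (auto simp: adjacency_cmod)
  also have "\<dots> = real (card ({..<length vs} \<inter> {j. (vs ! i, vs ! j) \<in> parcs G}))"
    by (simp add: sum.If_cases)
  also have "{..<length vs} \<inter> {j. (vs ! i, vs ! j) \<in> parcs G} = {j. j < length vs \<and> (vs ! i, vs ! j) \<in> parcs G}"
    by auto
  finally show ?thesis
    by (simp add: vertex_degree_conv[OF assms(1,2)])
qed

text \<open>By Hermitian symmetry the entry is a sum of squared moduli; these moduli are 0 or 1, so
  it equals the row sum of moduli.\<close>

lemma adjacency_square_diagonal:
  assumes "distinct vs" "set vs = pverts G" "i < length vs"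
  shows "Re ((adjacency_mat vs G \<phi> * adjacency_mat vs G \<phi>) $$ (i, i)) = real (vertex_degree G (vs ! i))"
proof -
  let ?A = "adjacency_mat vs G \<phi>"
  have "(?A * ?A) $$ (i, i) = (\<Sum>j<length vs. ?A $$ (i, j) * ?A $$ (j, i))"
    using assms(3) by (auto simp: scalar_prod_def lessThan_atLeast0 intro!: sum.cong)
  also have "\<dots> = (\<Sum>j<length vs. of_real (cmod (?A $$ (i, j))))"
  proof (rule sum.cong)
    fix j assume "j \<in> {..<length vs}"
    then have j: "j < length vs" by simp
    have "?A $$ (i, j) * ?A $$ (j, i) = of_real ((cmod (?A $$ (i, j)))\<^sup>2)"
      using adjacency_sym[OF assms(3) j] complex_norm_square[of "?A $$ (i, j)"] by simp
    then show "?A $$ (i, j) * ?A $$ (j, i) = of_real (cmod (?A $$ (i, j)))"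
      using adjacency_cmod[OF assms(3) j] by (simp split: if_splits)
  qed simp
  finally show ?thesis
    using adjacency_row_sum[OF assms] by simp
qed

section \<open>The cubic equation characterises switched balanced complete bipartite graphs\<close>

text \<open>If \<open>v\<^sub>i\<close> and \<open>v\<^sub>j\<close> are adjacent, the two sides of the bipartition are their neighbourhoods
  and every vertex is switched by the gain of the walk of length 1 or 2 joining \<open>v\<^sub>i\<close> to it.\<close>

lemma cube_imp_switching_complete_bipartite:
  assumes dist: "distinct vs" and set: "set vs = pverts G"
    and conn: "Digraph_Component.connected (with_proj G)" and ne: "parcs G \<noteq> {}"
    and cube: "adjacency_mat vs G \<phi> * adjacency_mat vs G \<phi> * adjacency_mat vs G \<phi>
      = of_real ((real (max_degree G))\<^sup>2) \<cdot>\<^sub>m adjacency_mat vs G \<phi>"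
  shows "\<exists>d H. complete_bipartite_digraph d d (with_proj H) \<and> pverts H = pverts G \<and>
    switching_equivalent vs G \<phi> H (\<lambda>_. 1)"
proof -
  define n where "n = length vs"
  define d where "d = max_degree G"
  define A where "A = adjacency_mat vs G \<phi>"
  define N where "N i = {j. j < n \<and> A $$ (i, j) \<noteq> 0}" for i
  have A: "A \<in> carrier_mat n n"
    by (simp add: A_def n_def)
  have herm: "A $$ (j, i) = cnj (A $$ (i, j))" if "i < n" "j < n" for i j
    using adjacency_sym[of i vs j] that by (simp add: A_def n_def)
  have unit: "A $$ (i, j) = 0 \<or> cmod (A $$ (i, j)) = 1" if "i < n" "j < n" for i j
    using adjacency_cmod[of i vs j] adjacency_eq_0_iff[of i vs j] that by (simp add: A_def n_def)
  have arc: "A $$ (i, j) \<noteq> 0 \<longleftrightarrow> (vs ! i, vs ! j) \<in> parcs G" if "i < n" "j < n" for i j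
    using adjacency_eq_0_iff[of i vs j] that by (simp add: A_def n_def)
  have "vertex_degree G (vs ! i) = card (N i)" if "i < n" for i
    unfolding vertex_degree_conv[OF dist set] N_def
    using arc that by (intro arg_cong[of _ _ card]) (auto simp: n_def)
  then have deg: "card {j. j < n \<and> A $$ (i, j) \<noteq> 0} \<le> d" if "i < n" for i
    using that vertex_degree_le_max[of "vs ! i"] nth_mem[of i vs] set by (simp add: N_def d_def n_def)
  have cube': "(\<Sum>x<n. \<Sum>y<n. A $$ (i, x) * A $$ (x, y) * A $$ (y, j)) = of_nat (d\<^sup>2) * A $$ (i, j)"
    if "i < n" "j < n" for i j
    using cube that unfolding A_def[symmetric] cube_eq_iff[OF A] by (simp add: d_def)
  note walks = three_walks_extremal[of n "\<lambda>i j. A $$ (i, j)" d]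
  \<comment> \<open>A single neighbour \<open>j\<close> already forces full degree, by the extremal
    property of the walks along the edge from \<open>i\<close> to \<open>j\<close>.\<close>
  have card_N: "card (N i) = d" if "j \<in> N i" "i < n" for i j
    unfolding N_def
    by (rule walks(1)[of i j]; use herm unit deg cube' that in \<open>unfold N_def, blast\<close>)
  have symN: "j \<in> N i \<longleftrightarrow> i \<in> N j" if "i < n" "j < n" for i j
    using herm[OF that] that by (auto simp: N_def)
  obtain u v where uv: "(u, v) \<in> parcs G"
    using ne by auto
  then have "u \<in> set vs" "v \<in> set vs"
    using in_arcsD1 in_arcsD2 set by blast+
  then obtain i j where i: "i < n" and j: "j < n" and vi: "vs ! i = u" and vj: "vs ! j = v"
    by (auto simp: in_set_conv_nth n_def)
  have aij: "A $$ (i, j) \<noteq> 0"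
    using arc[OF i j] uv vi vj by simp
  have ji: "i \<in> N j" and ij: "j \<in> N i"
    using i j aij symN by (auto simp: N_def)
  have finN: "finite (N k)" for k
    by (simp add: N_def)
  have gain: "A $$ (i, x) * A $$ (x, y) * A $$ (y, j) = A $$ (i, j)" if "x \<in> N i" "y \<in> N j" for x y
    by (rule walks(2)[of i j x y]; use herm unit deg cube' i j aij that in \<open>unfold N_def, blast\<close>)
  \<comment> \<open>All walks i, x, y, j have nonzero gain, so \<open>x\<close> is adjacent to all
    of \<open>N j\<close>; both sets have \<open>d\<close> elements, hence they coincide.\<close>
  have Ni: "N x = N j" if "x \<in> N i" for x
  proof -
    have x: "x < n" using that by (simp add: N_def)
    have "N j \<subseteq> N x"
    proof
      fix y assume y: "y \<in> N j"
      from gain[OF that y] aij have "A $$ (x, y) \<noteq> 0" by auto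
      with y show "y \<in> N x" by (simp add: N_def)
    qed
    moreover have "card (N x) = card (N j)"
      using card_N[OF ji j] card_N[of i x] symN[OF i x] that x by simp
    ultimately show ?thesis
      using finN by (metis card_subset_eq)
  qed
  have Nj: "N y = N i" if "y \<in> N j" for y
  proof -
    have y: "y < n" using that by (simp add: N_def)
    have "N i \<subseteq> N y"
    proof
      fix x assume x: "x \<in> N i"
      then have "y \<in> N x" using Ni that by simp
      then show "x \<in> N y"
        using symN[of x y] x y by (auto simp: N_def)
    qed
    moreover have "card (N y) = card (N i)"
      using card_N[OF ij i] card_N[of j y] symN[OF j y] that y by simp
    ultimately show ?thesis
      using finN by (metis card_subset_eq)
  qed
  \<comment> \<open>A common element \<open>x\<close> would lie in \<open>N j\<close>, which is
    \<open>N x\<close>, and so carry a loop.\<close>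
  have disj: "N i \<inter> N j = {}"
  proof -
    have "A $$ (x, x) = 0" if "x < n" for x
      using arc[OF that that] no_loops' by blast
    then have "x \<notin> N x" for x
      by (auto simp: N_def)
    then show ?thesis using Ni by blast
  qed
  \<comment> \<open>By \<open>Ni\<close> and \<open>Nj\<close>, neighbours of one side lie in the
    other, so the union is closed under arcs and connectedness makes it everything.\<close>
  have "pverts G \<subseteq> (!) vs ` (N i \<union> N j)"
  proof (rule connected_closed_set[OF gain_graph_axioms conn])
    show "u \<in> (!) vs ` (N i \<union> N j)"
      using ji vi by blast
    show "u \<in> pverts G"
      using nth_mem[of i vs] i by (simp add: vi set n_def)
    fix x y assume "x \<in> (!) vs ` (N i \<union> N j)" and xy: "(x, y) \<in> parcs G"
    then obtain p where p: "p \<in> N i \<union> N j" "x = vs ! p" by auto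
    have "y \<in> set vs"
      using in_arcsD2[OF xy] set by simp
    then obtain q where q: "q < n" "y = vs ! q"
      by (auto simp: in_set_conv_nth n_def)
    have "p < n" using p by (auto simp: N_def)
    then have "q \<in> N p"
      using arc[of p q] xy p q by (simp add: N_def)
    then have "q \<in> N i \<union> N j"
      using p Ni[of p] Nj[of p] by blast
    then show "y \<in> (!) vs ` (N i \<union> N j)"
      using q by blast
  qed
  then have cover: "k \<in> N i \<union> N j" if "k < n" for k
  proof -
    have "vs ! k \<in> (!) vs ` (N i \<union> N j)"
      using \<open>pverts G \<subseteq> _\<close> nth_mem[of k vs] that set by (auto simp: n_def)
    then obtain p where p: "p \<in> N i \<union> N j" "vs ! k = vs ! p"
      by blast
    then have "p < n"
      by (auto simp: N_def)
    then have "k = p"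
      using p(2) that nth_eq_iff_index_eq[OF dist] by (simp add: n_def)
    then show ?thesis
      using p(1) by simp
  qed
  have sub: "N i \<union> N j \<subseteq> {..<n}"
    by (auto simp: N_def)
  define U where "U = (!) vs ` N i"
  define V where "V = (!) vs ` N j"
  define H where "H = \<lparr>pverts = pverts G, parcs = U \<times> V \<union> V \<times> U\<rparr>"
  have inj: "inj_on ((!) vs) {..<n}"
    using dist by (auto simp: inj_on_def n_def nth_eq_iff_index_eq)
  have memU: "vs ! k \<in> U \<longleftrightarrow> k \<in> N i" and memV: "vs ! k \<in> V \<longleftrightarrow> k \<in> N j" if "k < n" for k
    unfolding U_def V_def using inj sub that by (auto dest: inj_onD)
  have "pverts G = U \<union> V"
  proof -
    have "pverts G = (!) vs ` {..<n}"
      unfolding set[symmetric] n_def by (auto simp: in_set_conv_nth)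
    also have "{..<n} = N i \<union> N j"
      using cover sub by auto
    finally show ?thesis
      by (simp add: U_def V_def image_Un)
  qed
  moreover have "U \<inter> V = {}"
    unfolding U_def V_def using disj inj sub by (subst inj_on_image_Int[symmetric]) auto
  moreover have "card U = d" "card V = d"
    unfolding U_def V_def using card_N[OF ij i] card_N[OF ji j] inj sub
    by (auto simp: card_image inj_on_subset)
  ultimately have K: "complete_bipartite_digraph d d (with_proj H)"
    unfolding complete_bipartite_digraph_pair_def using pair_finite_verts by (auto simp: H_def)
  \<comment> \<open>Potential based at \<open>v_i\<close>: side \<open>N i\<close> is reached
    directly, side \<open>N j\<close> through \<open>v_j\<close>. The base vertex itself lies in
    \<open>N j\<close> and gets the value 1.\<close>
  define w where "w k = (if k \<in> N i then A $$ (i, k) else A $$ (i, j) * A $$ (j, k))" for k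
  have w1: "cmod (w k) = 1" if k: "k < n" for k
  proof (cases "k \<in> N i")
    case True
    then show ?thesis using unit[OF i k] by (auto simp: w_def N_def)
  next
    case False
    then have "k \<in> N j" using cover k by blast
    then show ?thesis
      using False unit[OF i j] unit[OF j k] aij by (auto simp: w_def N_def norm_mult)
  qed
  \<comment> \<open>The product is the gain of the closed walk i, x, y, j, i, which
    \<open>gain\<close> shows to be 1.\<close>
  have switch: "w x * A $$ (x, y) * cnj (w y) = 1" if x: "x \<in> N i" and y: "y \<in> N j" for x y
  proof -
    have "y < n" using y by (simp add: N_def)
    have "w x * A $$ (x, y) * cnj (w y)
        = (A $$ (i, x) * A $$ (x, y) * A $$ (y, j)) * cnj (A $$ (i, j))"
      using x y disj herm[OF j \<open>y < n\<close>] by (auto simp: w_def mult_ac)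
    also have "\<dots> = of_real ((cmod (A $$ (i, j)))\<^sup>2)"
      unfolding gain[OF x y] complex_norm_square ..
    finally show ?thesis
      using unit[OF i j] aij by simp
  qed
  define D where "D = mat_diag n w"
  have D: "D \<in> carrier_mat n n"
    by (simp add: D_def)
  have DAD: "(D * A * mat_adjoint D) $$ (p, q) = w p * A $$ (p, q) * cnj (w q)" if "p < n" "q < n" for p q
    unfolding D_def mat_adjoint_mat_diag mat_diag_mult_left[OF A]
    using that by (subst mat_diag_mult_right[of _ n]) auto
  have "adjacency_mat vs H (\<lambda>_. 1) = D * A * mat_adjoint D"
  proof (rule eq_matI)
    fix p q assume "p < dim_row (D * A * mat_adjoint D)" "q < dim_col (D * A * mat_adjoint D)"
    then have pq: "p < n" "q < n"
      using D by auto
    have "adjacency_mat vs H (\<lambda>_. 1) $$ (p, q)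
        = (if p \<in> N i \<and> q \<in> N j \<or> p \<in> N j \<and> q \<in> N i then 1 else 0)"
      using pq memU memV by (simp add: adjacency_mat_def H_def n_def)
    also have "\<dots> = w p * A $$ (p, q) * cnj (w q)"
    proof -
      consider "p \<in> N i" "q \<in> N j" | "p \<in> N j" "q \<in> N i" | "p \<in> N i" "q \<in> N i" | "p \<in> N j" "q \<in> N j"
        using cover pq by blast
      then show ?thesis
      proof cases
        case 1
        then show ?thesis using switch by simp
      next
        case 2
        then show ?thesis
          using arg_cong[OF switch[OF 2(2,1)], of cnj] herm[OF pq] by (simp add: mult_ac)
      next
        case 3
        \<comment> \<open>The neighbourhood of \<open>p\<close> is the opposite side, so there is no
          edge inside \<open>N i\<close>.\<close>
        then have "A $$ (p, q) = 0"
          using Ni[of p] disj pq by (auto simp: N_def)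
        then show ?thesis using 3 disj by auto
      next
        case 4
        then have "A $$ (p, q) = 0"
          using Nj[of p] disj pq by (auto simp: N_def)
        then show ?thesis using 4 disj by auto
      qed
    qed
    finally show "adjacency_mat vs H (\<lambda>_. 1) $$ (p, q) = (D * A * mat_adjoint D) $$ (p, q)"
      unfolding DAD[OF pq] .
  qed (use D in \<open>auto simp: adjacency_mat_def n_def\<close>)
  moreover have "diagonal_mat D"
    by (auto simp: D_def diagonal_mat_def mat_diag_def)
  moreover have "unitary_mat D"
  proof -
    have "D * mat_adjoint D = mat_diag n (\<lambda>k. w k * cnj (w k))"
      by (simp add: D_def)
    also have "\<dots> = 1\<^sub>m n"
      using w1 by (intro eq_matI) (auto simp: mat_diag_def complex_norm_square[symmetric])
    finally show ?thesis
      using D by (auto simp: unitary_mat_def)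
  qed
  ultimately have "switching_equivalent vs G \<phi> H (\<lambda>_. 1)"
    unfolding switching_equivalent_def using D by (auto simp: A_def n_def)
  with K show ?thesis
    by (auto simp: H_def intro!: exI[of _ d] exI[of _ H])
qed

text \<open>Undoing the switching writes each gain as a quotient of vertex values. Along a walk of
  length 3 the inner values cancel, leaving the gain from start to end, and there are
  \<open>d * d\<close> such walks between opposite sides and none within a side.\<close>

lemma switching_complete_bipartite_imp_cube:
  assumes dist: "distinct vs" and set: "set vs = pverts G" and ne: "parcs G \<noteq> {}"
    and K: "complete_bipartite_digraph d d (with_proj H)" and vH: "pverts H = pverts G"
    and sw: "switching_equivalent vs G \<phi> H (\<lambda>_. 1)"
  shows "adjacency_mat vs G \<phi> * adjacency_mat vs G \<phi> * adjacency_mat vs G \<phi>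
    = of_real ((real (max_degree G))\<^sup>2) \<cdot>\<^sub>m adjacency_mat vs G \<phi>"
proof -
  define n where "n = length vs"
  define A where "A = adjacency_mat vs G \<phi>"
  have A: "A \<in> carrier_mat n n"
    by (simp add: A_def n_def)
  obtain U V where UV: "pverts G = U \<union> V" "U \<inter> V = {}" "card U = d" "card V = d"
    and arcsH: "parcs H = U \<times> V \<union> V \<times> U"
    using K vH by (auto simp: complete_bipartite_digraph_pair_def)
  \<comment> \<open>Recording the side as a Boolean lets one count, \<open>card_s\<close>, serve
    both parts of the bipartition.\<close>
  define s where "s i \<longleftrightarrow> vs ! i \<in> U" for i
  have V_iff: "vs ! i \<in> V \<longleftrightarrow> \<not> s i" if "i < n" for i
    using UV(1,2) set that nth_mem[of i vs] by (auto simp: s_def n_def)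
  have card_s: "card {i. i < n \<and> s i = b} = d" for b
  proof (cases b)
    case True
    then show ?thesis
      using card_nth_Collect[OF dist, of U] UV set by (simp add: s_def n_def Int_absorb1)
  next
    case False
    then have "{i. i < n \<and> s i = b} = {i. i < n \<and> vs ! i \<in> V}"
      using V_iff by auto
    then show ?thesis
      using card_nth_Collect[OF dist, of V] UV set by (simp add: n_def Int_absorb1)
  qed
  obtain D where D: "D \<in> carrier_mat n n" "diagonal_mat D" "unitary_mat D"
    and AH: "adjacency_mat vs H (\<lambda>_. 1) = D * A * mat_adjoint D"
    using sw by (auto simp: switching_equivalent_def A_def n_def)
  define w where "w i = D $$ (i, i)" for i
  have Dw: "D = mat_diag n w"
    using D by (intro eq_matI) (auto simp: mat_diag_def w_def diagonal_mat_def)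
  have ww: "w i * cnj (w i) = 1" if "i < n" for i
  proof -
    have "mat_diag n (\<lambda>k. w k * cnj (w k)) = 1\<^sub>m n"
      using D carrier_matD[OF mat_diag_dim[of n w]] by (simp add: unitary_mat_def Dw)
    from arg_cong[OF this, of "\<lambda>X. X $$ (i, i)"] that show ?thesis
      by (simp add: mat_diag_def)
  qed
  have ent: "w p * A $$ (p, q) * cnj (w q) = (if s p \<noteq> s q then 1 else 0)" if "p < n" "q < n" for p q
  proof -
    have "w p * A $$ (p, q) * cnj (w q) = (D * A * mat_adjoint D) $$ (p, q)"
      unfolding Dw mat_adjoint_mat_diag mat_diag_mult_left[OF A]
      using that by (subst mat_diag_mult_right[of _ n]) auto
    also have "\<dots> = (if s p \<noteq> s q then 1 else 0)"
      unfolding AH[symmetric] using that V_iff[OF that(1)] V_iff[OF that(2)]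
      by (auto simp: adjacency_mat_def arcsH s_def n_def)
    finally show ?thesis .
  qed
  have A_ent: "A $$ (p, q) = cnj (w p) * w q * (if s p \<noteq> s q then 1 else 0)" if "p < n" "q < n" for p q
  proof -
    have "A $$ (p, q) = (w p * cnj (w p)) * A $$ (p, q) * (w q * cnj (w q))"
      using ww that by simp
    also have "\<dots> = cnj (w p) * w q * (w p * A $$ (p, q) * cnj (w q))"
      by (simp add: mult_ac)
    finally show ?thesis
      unfolding ent[OF that] .
  qed
  have "vertex_degree G (vs ! i) = d" if "i < n" for i
  proof -
    have "w k \<noteq> 0" if "k < n" for k
      using ww[OF that] by auto
    then have "(vs ! i, vs ! j) \<in> parcs G \<longleftrightarrow> s j = (\<not> s i)" if "j < n" for j
    proof -
      have "(vs ! i, vs ! j) \<in> parcs G \<longleftrightarrow> A $$ (i, j) \<noteq> 0"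
        using adjacency_eq_0_iff[of i vs j] \<open>i < n\<close> that by (simp add: A_def n_def)
      also have "\<dots> \<longleftrightarrow> s j = (\<not> s i)"
        unfolding A_ent[OF \<open>i < n\<close> that] using \<open>\<And>k. k < n \<Longrightarrow> w k \<noteq> 0\<close> \<open>i < n\<close> that by auto
      finally show ?thesis .
    qed
    then have "{j. j < n \<and> (vs ! i, vs ! j) \<in> parcs G} = {j. j < n \<and> s j = (\<not> s i)}"
      by auto
    then show ?thesis
      unfolding vertex_degree_conv[OF dist set] using card_s by (simp add: n_def)
  qed
  then have "vertex_degree G v = d" if "v \<in> pverts G" for v
    using that set by (metis in_set_conv_nth n_def)
  \<comment> \<open>All degrees equal \<open>d\<close>; nonemptiness ensures that the maximum is
    taken over the singleton of \<open>d\<close>.\<close>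
  moreover have "pverts G \<noteq> {}"
    using ne in_arcsD1 by fastforce
  ultimately have max: "max_degree G = d"
    unfolding max_degree_def by simp
  have count: "(\<Sum>x<n. if s x = b then 1 else 0) = (of_nat d :: complex)" for b
  proof -
    have "{..<n} \<inter> {x. s x = b} = {i. i < n \<and> s i = b}"
      by auto
    then show ?thesis
      using card_s by (simp add: sum.If_cases)
  qed
  have "A * A * A = of_nat (d\<^sup>2) \<cdot>\<^sub>m A"
    unfolding cube_eq_iff[OF A]
  proof (intro allI impI)
    fix i j assume i: "i < n" and j: "j < n"
    \<comment> \<open>This is the entry of \<open>A\<close> at (i, j). In a walk i, x, y, j the
      sides alternate, so the conditions on \<open>x\<close> and \<open>y\<close> separate and the
      double sum factorises into two counts.\<close>
    define c where "c = (if s i \<noteq> s j then cnj (w i) * w j else 0)"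
    have "(\<Sum>x<n. \<Sum>y<n. A $$ (i, x) * A $$ (x, y) * A $$ (y, j))
        = (\<Sum>x<n. \<Sum>y<n. (if s x = (\<not> s i) then 1 else 0) * ((if s y = s i then 1 else 0) * c))"
    proof (intro sum.cong refl)
      fix x y assume "x \<in> {..<n}" "y \<in> {..<n}"
      then have xy: "x < n" "y < n" by auto
      have "A $$ (i, x) * A $$ (x, y) * A $$ (y, j) = cnj (w i) * w j * (w x * cnj (w x)) * (w y * cnj (w y))
          * ((if s i \<noteq> s x then 1 else 0) * (if s x \<noteq> s y then 1 else 0) * (if s y \<noteq> s j then 1 else 0))"
        unfolding A_ent[OF i xy(1)] A_ent[OF xy] A_ent[OF xy(2) j] by (simp add: mult_ac)
      then show "A $$ (i, x) * A $$ (x, y) * A $$ (y, j)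
          = (if s x = (\<not> s i) then 1 else 0) * ((if s y = s i then 1 else 0) * c)"
        unfolding ww[OF xy(1)] ww[OF xy(2)] c_def by auto
    qed
    also have "\<dots> = (\<Sum>x<n. if s x = (\<not> s i) then 1 else 0) * ((\<Sum>y<n. if s y = s i then 1 else 0) * c)"
      by (simp only: sum_distrib_left[symmetric] sum_distrib_right[symmetric])
    also have "\<dots> = of_nat d * (of_nat d * c)"
      by (simp only: count)
    also have "\<dots> = of_nat (d\<^sup>2) * A $$ (i, j)"
      unfolding A_ent[OF i j] by (simp add: c_def power2_eq_square)
    finally show "(\<Sum>x<n. \<Sum>y<n. A $$ (i, x) * A $$ (x, y) * A $$ (y, j)) = of_nat (d\<^sup>2) * A $$ (i, j)" .
  qed
  then show ?thesis
    by (simp add: max A_def)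
qed

end

theorem theorem3p9:
  fixes G :: "'a pair_pre_digraph" and \<phi> :: "'a \<times> 'a \<Rightarrow> complex" and vs :: "'a list"
  assumes "gain_graph G \<phi>"
    and "distinct vs" and "set vs = pverts G"
    and "Digraph_Component.connected (with_proj G)"
    and "parcs G \<noteq> {}"
  shows "(\<forall>i < length vs.
            vertex_energy vs G \<phi> i \<ge> real (vertex_degree G (vs ! i)) / real (max_degree G)) \<and>
         ((\<forall>i < length vs.
            vertex_energy vs G \<phi> i = real (vertex_degree G (vs ! i)) / real (max_degree G)) \<longleftrightarrow>
          (\<exists>d H. complete_bipartite_digraph d d (with_proj H) \<and> pverts H = pverts G \<and>
            switching_equivalent vs G \<phi> H (\<lambda>_. 1)))"
proof -
  interpret gain_graph G \<phi> by fact
  have row: "(\<Sum>j<length vs. cmod (adjacency_mat vs G \<phi> $$ (i, j))) \<le> real (max_degree G)"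
    if "i < length vs" for i
    using adjacency_row_sum[OF assms(2,3) that] vertex_degree_le_max[of "vs ! i"] nth_mem[OF that] assms(3) by simp
  have pos: "real (max_degree G) > 0"
    using max_degree_pos[OF assms(5)] by simp
  note bound = hermitian_energy_bound[OF adjacency_carrier adjacency_hermitian row pos, folded vertex_energy_def]
  have diag: "Re ((adjacency_mat vs G \<phi> * adjacency_mat vs G \<phi>) $$ (i, i)) = real (vertex_degree G (vs ! i))"
    if "i < length vs" for i
    by (rule adjacency_square_diagonal[OF assms(2,3) that])
  \<comment> \<open>Equality and the graph-theoretic characterisation are each matched with the
    cubic matrix equation.\<close>
  have "(\<forall>i < length vs.
            vertex_energy vs G \<phi> i = real (vertex_degree G (vs ! i)) / real (max_degree G)) \<longleftrightarrow>
     adjacency_mat vs G \<phi> * adjacency_mat vs G \<phi> * adjacency_mat vs G \<phi>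
      = of_real ((real (max_degree G))\<^sup>2) \<cdot>\<^sub>m adjacency_mat vs G \<phi>"
    using bound(2) diag by simp
  also have "\<dots> \<longleftrightarrow> (\<exists>d H. complete_bipartite_digraph d d (with_proj H) \<and> pverts H = pverts G \<and>
            switching_equivalent vs G \<phi> H (\<lambda>_. 1))"
    using cube_imp_switching_complete_bipartite[OF assms(2-5)]
      switching_complete_bipartite_imp_cube[OF assms(2,3,5)] by blast
  finally show ?thesis
    using bound(1) diag by auto
qed

end
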